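(* Let $m>1$ and $\alpha>0$. Then the simultaneous closed eBH procedure $\boldsymbol{\mathcal R}^{\overline{\mathrm{eBH}}}_\alpha$ is a uniform improvement in both simultaneity and power over the eBH procedure $\mathbf R^{\mathrm{eBH}}_\alpha$.
   Context: Data are vectors of e-values $x=(\mathbf e_1,\dots,\mathbf e_m)\in[0,\infty)^m$; every such vector is a possible data realization. $[m]=\{1,\dots,m\}$ and $\mathrm{FDP}_S(R)=|R\cap S|/(|R|\vee1)$. eBH: let $\mathbf e_{(r)}$ be the $r$th largest e-value and let $\mathbf R^{(r)}$ be the set of indices of the $r$ largest e-values (ties broken by smallest index), $\mathbf R^{(0)}=\emptyset$. Then $\mathbf R^{\mathrm{eBH}}_\alpha=\mathbf R^{(\mathbf r)}$ with $\mathbf r=\max\{1\le r\le m: r\,\mathbf e_{(r)}\ge m/\alpha\}$, and $\mathbf r=0$ if no such $r$ exists. Closed eBH: $$\boldsymbol{\mathcal R}^{\overline{\mathrm{eBH}}}_\alpha=\Big\{R\in 2^{[m]}:\ \frac1{|S|}\sum_{i\in S}\mathbf e_i\ge\frac{\mathrm{FDP}_S(R)}{\alpha}\ \text{ for all nonempty } S\subseteq[m]\Big\}$$ (the condition for $S=\emptyset$ is vacuous, both sides being $0$ by convention). Definitions. Let $\boldsymbol{\mathcal R}(x)\subseteq 2^{[m]}$ be the collection returned by a simultaneous procedure and $\mathbf S(x)\subseteq[m]$ the set returned by a classical procedure at data realization $x$. $\boldsymbol{\mathcal R}$ is a uniform simultaneity improvement over $\mathbf S$ if $\mathbf S(x)\in\boldsymbol{\mathcal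 R}(x)$ for every $x$ and, for at least one $x$, $\boldsymbol{\mathcal R}(x)$ also contains a nonempty set $R\ne\mathbf S(x)$. It is a uniform power improvement if for every $x$ there is $R\in\boldsymbol{\mathcal R}(x)$ with $R\supseteq\mathbf S(x)$ and, for at least one $x$, $\boldsymbol{\mathcal R}(x)$ also contains a nonempty set $R\supsetneq\mathbf S(x)$. *)

theory Defs
  imports Complex_Main "HOL-Library.FuncSet"
begin

text \<open>Vectors in $[0,\infty)^m$, indexed by $\{1,\dots,m\}$.\<close>

definition evalue_space :: "nat \<Rightarrow> (nat \<Rightarrow> real) set" where
  "evalue_space m = {1..m} \<rightarrow>\<^sub>E {0..}"

definition FDP :: "nat set \<Rightarrow> nat set \<Rightarrow> real" where
  "FDP S R = real (card (R \<inter> S)) / real (max (card R) 1)"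

text \<open>The indices in order of decreasing e-value. As \<^const>\<open>sort_key\<close> is stable,
  indices with equal e-values appear in increasing order.\<close>

definition ranking :: "nat \<Rightarrow> (nat \<Rightarrow> real) \<Rightarrow> nat list" where
  "ranking m x = sort_key (\<lambda>i. - x i) [1..<Suc m]"

text \<open>Lists are indexed from 0, ranks from 1; \<open>rth_largest\<close> is only meaningful for
  \<open>1 \<le> r \<le> m\<close>.\<close>

definition rth_largest :: "nat \<Rightarrow> (nat \<Rightarrow> real) \<Rightarrow> nat \<Rightarrow> real" where
  "rth_largest m x r = x (ranking m x ! (r - 1))"

definition top_indices :: "nat \<Rightarrow> (nat \<Rightarrow> real) \<Rightarrow> nat \<Rightarrow> nat set" where
  "top_indices m x r = set (take r (ranking m x))"

definition eBH_ranks :: "nat \<Rightarrow> real \<Rightarrow> (nat \<Rightarrow> real) \<Rightarrow> nat set" where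
  "eBH_ranks m \<alpha> x = {r \<in> {1..m}. real r * rth_largest m x r \<ge> real m / \<alpha>}"

definition eBH_count :: "nat \<Rightarrow> real \<Rightarrow> (nat \<Rightarrow> real) \<Rightarrow> nat" where
  "eBH_count m \<alpha> x = (if eBH_ranks m \<alpha> x = {} then 0 else Max (eBH_ranks m \<alpha> x))"

definition eBH :: "nat \<Rightarrow> real \<Rightarrow> (nat \<Rightarrow> real) \<Rightarrow> nat set" where
  "eBH m \<alpha> x = top_indices m x (eBH_count m \<alpha> x)"

definition closed_eBH :: "nat \<Rightarrow> real \<Rightarrow> (nat \<Rightarrow> real) \<Rightarrow> nat set set" where
  "closed_eBH m \<alpha> x =
    {R \<in> Pow {1..m}. \<forall>S. S \<subseteq> {1..m} \<and> S \<noteq> {} \<longrightarrow>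
       (1 / real (card S)) * (\<Sum>i\<in>S. x i) \<ge> FDP S R / \<alpha>}"

text \<open>Both notions of improvement are relative to the set \<open>X\<close> of possible data realizations.\<close>

definition uniform_simultaneity_improvement ::
  "'x set \<Rightarrow> ('x \<Rightarrow> 'i set set) \<Rightarrow> ('x \<Rightarrow> 'i set) \<Rightarrow> bool" where
  "uniform_simultaneity_improvement X \<R> S \<longleftrightarrow>
     (\<forall>x\<in>X. S x \<in> \<R> x) \<and> (\<exists>x\<in>X. \<exists>R\<in>\<R> x. R \<noteq> {} \<and> R \<noteq> S x)"

definition uniform_power_improvement ::
  "'x set \<Rightarrow> ('x \<Rightarrow> 'i set set) \<Rightarrow> ('x \<Rightarrow> 'i set) \<Rightarrow> bool" where
  "uniform_power_improvement X \<R> S \<longleftrightarrow>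
     (\<forall>x\<in>X. \<exists>R\<in>\<R> x. S x \<subseteq> R) \<and> (\<exists>x\<in>X. \<exists>R\<in>\<R> x. R \<noteq> {} \<and> S x \<subset> R)"

end

theory Submission imports Defs begin

text \<open>
  If eBH rejects \<open>R\<close> with \<open>|R| = r\<close>, every e-value in \<open>R\<close> is at least \<open>m / (r \<alpha>)\<close>, so the average
  over \<open>S\<close> is at least \<open>|R \<inter> S| m / (|S| r \<alpha>) \<ge> FDP\<^sub>S(R) / \<alpha>\<close>. For the strict improvement, let
  the first e-value be \<open>(m + 1) / (2\<alpha>)\<close> and all others \<open>1 / (2\<alpha>)\<close>: then eBH rejects nothing, while
  the average over any \<open>S\<close> containing 1 is \<open>(m + |S|) / (2\<alpha>|S|) \<ge> 1 / \<alpha>\<close>, so closed eBH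
  rejects \<open>{1}\<close>.
\<close>

lemma length_ranking [simp]: "length (ranking m x) = m"
  by (simp add: ranking_def)

lemma set_ranking [simp]: "set (ranking m x) = {1..m}"
  by (auto simp: ranking_def simp del: upt_Suc)

lemma distinct_ranking [simp]: "distinct (ranking m x)"
  by (simp add: ranking_def del: upt_Suc)

lemma ranking_antimono:
  assumes "i \<le> j" "j < m"
  shows "x (ranking m x ! j) \<le> x (ranking m x ! i)"
proof -
  \<comment> \<open>The sort key is the negated e-value, so ascending keys mean descending
    e-values.\<close>
  have "sorted (map (\<lambda>i. - x i) (ranking m x))"
    by (simp add: ranking_def del: upt_Suc)
  from sorted_nth_mono[OF this \<open>i \<le> j\<close>] assms show ?thesis
    by simp
qed

lemma top_indices_subset: "top_indices m x r \<subseteq> {1..m}"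
  unfolding top_indices_def by (metis set_ranking set_take_subset)

lemma card_top_indices: "r \<le> m \<Longrightarrow> card (top_indices m x r) = r"
  by (simp add: top_indices_def distinct_card)

lemma rth_largest_le_top_indices:
  assumes "i \<in> top_indices m x r" "r \<le> m"
  shows "rth_largest m x r \<le> x i"
proof -
  obtain j where "j < r" "i = ranking m x ! j"
    using assms by (auto simp: top_indices_def in_set_conv_nth)
  then show ?thesis
    \<comment> \<open>Rank \<open>r\<close> sits at list position \<open>r - 1\<close>; here
      \<open>j < r\<close> makes \<open>r\<close> positive, so the truncated subtraction is
      harmless.\<close>
    using ranking_antimono[of j "r - 1" m x] assms by (simp add: rth_largest_def)
qed

text \<open>The top \<open>r\<close> indices all qualify, and ties can only add more. This turns a
  bound on how many e-values reach a level into a bound on the rank.\<close>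

lemma card_ge_rth_largest:
  assumes "r \<le> m"
  shows "r \<le> card {i \<in> {1..m}. rth_largest m x r \<le> x i}"
proof -
  have "top_indices m x r \<subseteq> {i \<in> {1..m}. rth_largest m x r \<le> x i}"
    using top_indices_subset rth_largest_le_top_indices[OF _ assms] by blast
  from card_mono[OF _ this] show ?thesis
    by (simp add: card_top_indices[OF assms])
qed

lemma eBH_count_in_ranks:
  assumes "eBH_ranks m \<alpha> x \<noteq> {}"
  shows "eBH_count m \<alpha> x \<in> eBH_ranks m \<alpha> x"
proof -
  have "finite (eBH_ranks m \<alpha> x)"
    by (simp add: eBH_ranks_def)
  with assms show ?thesis
    by (simp add: eBH_count_def)
qed

lemma eBH_empty: "eBH_ranks m \<alpha> x = {} \<Longrightarrow> eBH m \<alpha> x = {}"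
  by (simp add: eBH_def eBH_count_def top_indices_def)

text \<open>Covers the case where eBH rejects nothing: the FDP is 0, and averages of e-values are
  nonnegative.\<close>

lemma empty_in_closed_eBH:
  assumes "x \<in> evalue_space m"
  shows "{} \<in> closed_eBH m \<alpha> x"
  using assms by (auto simp: closed_eBH_def FDP_def evalue_space_def intro!: divide_nonneg_nonneg sum_nonneg)

lemma eBH_in_closed_eBH:
  assumes "\<alpha> > 0" and x: "x \<in> evalue_space m"
  shows "eBH m \<alpha> x \<in> closed_eBH m \<alpha> x"
proof (cases "eBH_ranks m \<alpha> x = {}")
  case True
  then show ?thesis
    by (simp add: eBH_empty empty_in_closed_eBH[OF x])
next
  case False
  define r where "r = eBH_count m \<alpha> x"
  define R where "R = top_indices m x r"
  have r: "1 \<le> r" "r \<le> m" and e: "real m / \<alpha> \<le> real r * rth_largest m x r"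
    using eBH_count_in_ranks[OF False] by (auto simp: eBH_ranks_def r_def)
  have R: "R \<subseteq> {1..m}" "card R = r"
    using r top_indices_subset by (auto simp: R_def card_top_indices)
  have ge: "real m / (\<alpha> * r) \<le> x i" if "i \<in> R" for i
  proof -
    have "real m / (\<alpha> * r) \<le> rth_largest m x r"
      using e r \<open>\<alpha> > 0\<close> by (simp add: field_simps)
    also have "\<dots> \<le> x i"
      using rth_largest_le_top_indices that r by (simp add: R_def)
    finally show ?thesis .
  qed
  have "FDP S R / \<alpha> \<le> 1 / real (card S) * (\<Sum>i\<in>S. x i)" if S: "S \<subseteq> {1..m}" "S \<noteq> {}" for S
  proof -
    have fin: "finite S"
      using S finite_subset by blast
    have cS: "0 < card S" "card S \<le> m"
      using S fin card_mono[OF _ S(1)] by (auto simp: card_gt_0_iff)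
    \<comment> \<open>Since \<open>r\<close> is at least 1, the maximum with 1 in \<open>FDP\<close>
      is \<open>r\<close> itself.\<close>
    have "FDP S R / \<alpha> = card (R \<inter> S) / (\<alpha> * r)"
      using r R by (simp add: FDP_def max_def mult.commute)
    \<comment> \<open>Inserts the factor m / |S|, which is at least 1.\<close>
    also have "\<dots> \<le> 1 / real (card S) * (real m * (card (R \<inter> S) / (\<alpha> * r)))"
      using cS \<open>\<alpha> > 0\<close> mult_right_mono[of 1 "real m / card S" "card (R \<inter> S) / (\<alpha> * r)"]
      by simp
    also have "real m * (card (R \<inter> S) / (\<alpha> * r)) \<le> (\<Sum>i\<in>R \<inter> S. x i)"
      using sum_bounded_below[of "R \<inter> S" "real m / (\<alpha> * r)" x] ge by (simp add: mult.commute)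
    \<comment> \<open>The indices of \<open>S\<close> outside \<open>R\<close> contribute
      nonnegative terms.\<close>
    also have "\<dots> \<le> (\<Sum>i\<in>S. x i)"
      using fin S x by (intro sum_mono2) (auto simp: evalue_space_def PiE_def Pi_def)
    finally show ?thesis
      using cS by (simp add: divide_right_mono)
  qed
  then show ?thesis
    using R by (auto simp: closed_eBH_def eBH_def R_def r_def)
qed

text \<open>The spike exceeds the baseline 1 / (2\<alpha>) by m / (2\<alpha>), the least excess for
  which the average over all m indices reaches 1 / \<alpha>.\<close>

definition spiked_evalues :: "nat \<Rightarrow> real \<Rightarrow> nat \<Rightarrow> real" where
  "spiked_evalues m \<alpha> = (\<lambda>i\<in>{1..m}. if i = 1 then (real m + 1) / (2 * \<alpha>) else 1 / (2 * \<alpha>))"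

lemma spiked_evalues_in_space: "\<alpha> > 0 \<Longrightarrow> spiked_evalues m \<alpha> \<in> evalue_space m"
  by (auto simp: evalue_space_def spiked_evalues_def)

lemma eBH_spiked_evalues:
  assumes "m > 1" "\<alpha> > 0"
  shows "eBH m \<alpha> (spiked_evalues m \<alpha>) = {}"
proof (rule eBH_empty, rule ccontr)
  let ?x = "spiked_evalues m \<alpha>"
  assume "eBH_ranks m \<alpha> ?x \<noteq> {}"
  then obtain r where r: "1 \<le> r" "r \<le> m" and ge: "real m / \<alpha> \<le> real r * rth_largest m ?x r"
    by (auto simp: eBH_ranks_def)
  show False
  \<comment> \<open>At or below the baseline, even the rank m yields only m / (2\<alpha>). Above it,
    only index 1 reaches the level, so the rank is 1.\<close>
  proof (cases "rth_largest m ?x r \<le> 1 / (2 * \<alpha>)")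
    case True
    then have "real r * rth_largest m ?x r \<le> real m * (1 / (2 * \<alpha>))"
      using r assms by (intro order.trans[OF mult_left_mono[OF True] mult_right_mono]) auto
    with ge assms show False
      by (simp add: field_simps)
  next
    case False
    then have "{i \<in> {1..m}. rth_largest m ?x r \<le> ?x i} \<subseteq> {1}"
      by (auto simp: spiked_evalues_def split: if_splits)
    from card_mono[OF _ this] card_ge_rth_largest[OF r(2), of ?x] r(1) have "r = 1"
      by simp
    have "ranking m ?x ! 0 \<in> {1..m}"
      using assms by (metis length_ranking nth_mem set_ranking less_trans zero_less_one)
    then have "rth_largest m ?x 1 \<le> (real m + 1) / (2 * \<alpha>)"
      using assms by (auto simp: rth_largest_def spiked_evalues_def divide_right_mono)
    \<comment> \<open>The spike (m + 1) / (2\<alpha>) lies strictly below m / \<alpha> because m >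
      1.\<close>
    with ge \<open>r = 1\<close> assms show False
      by (simp add: field_simps)
  qed
qed

lemma sum_spiked_evalues:
  assumes "S \<subseteq> {1..m}" "1 \<in> S"
  shows "(\<Sum>i\<in>S. spiked_evalues m \<alpha> i) = (real m + real (card S)) / (2 * \<alpha>)"
proof -
  have fin: "finite S"
    using assms finite_subset by blast
  have "(\<Sum>i\<in>S. spiked_evalues m \<alpha> i) = (\<Sum>i\<in>S. 1 / (2 * \<alpha>) + (if i = 1 then real m / (2 * \<alpha>) else 0))"
    using assms by (intro sum.cong) (auto simp: spiked_evalues_def add_divide_distrib)
  also have "\<dots> = (real m + real (card S)) / (2 * \<alpha>)"
    using fin assms by (simp add: sum.distrib add_divide_distrib)
  finally show ?thesis .
qed

lemma singleton_in_closed_eBH_spiked_evalues: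
  assumes "m > 1" "\<alpha> > 0"
  shows "{1} \<in> closed_eBH m \<alpha> (spiked_evalues m \<alpha>)"
proof -
  let ?x = "spiked_evalues m \<alpha>"
  have "FDP S {1} / \<alpha> \<le> 1 / real (card S) * (\<Sum>i\<in>S. ?x i)" if S: "S \<subseteq> {1..m}" "S \<noteq> {}" for S
  proof (cases "1 \<in> S")
    case True
    have "finite S"
      using S finite_subset by blast
    then have "0 < card S" "card S \<le> m"
      using S card_mono[OF _ S(1)] by (auto simp: card_gt_0_iff)
    \<comment> \<open>The claim reduces to m + |S| \<ge> 2 |S|, that is, |S| \<le> m.\<close>
    with True assms show ?thesis
      by (simp add: sum_spiked_evalues[OF S(1) True] FDP_def field_simps)
  next
    case False
    then show ?thesis
      using S spiked_evalues_in_space[OF assms(2), of m]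
      by (auto simp: FDP_def evalue_space_def PiE_def Pi_def intro!: divide_nonneg_nonneg sum_nonneg)
  qed
  then show ?thesis
    using assms by (auto simp: closed_eBH_def)
qed

theorem theorem17:
  fixes m :: nat and \<alpha> :: real
  assumes "m > 1" and "\<alpha> > 0"
  shows "uniform_simultaneity_improvement (evalue_space m) (closed_eBH m \<alpha>) (eBH m \<alpha>)
       \<and> uniform_power_improvement (evalue_space m) (closed_eBH m \<alpha>) (eBH m \<alpha>)"
proof -
  note space = spiked_evalues_in_space[OF assms(2), of m]
    and singleton = singleton_in_closed_eBH_spiked_evalues[OF assms]
    and empty = eBH_spiked_evalues[OF assms]
  \<comment> \<open>One witness serves both notions, as a strict superset of the eBH set also
    differs from it.\<close>
  have "\<exists>x\<in>evalue_space m. \<exists>R\<in>closed_eBH m \<alpha> x. R \<noteq> {} \<and> eBH m \<alpha> x \<subset> R"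
    by (intro bexI[OF _ space] bexI[OF _ singleton]) (auto simp: empty)
  with eBH_in_closed_eBH[OF assms(2)] show ?thesis
    unfolding uniform_simultaneity_improvement_def uniform_power_improvement_def by blast
qed

end
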